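(* Let $X$ be a finite retractable indecomposable q-cycle set such that $|X|$ is not a prime number. Then $\mathcal{G}(X)$ acts imprimitively on $X$.
   Context: A q-cycle set is a non-empty set $X$ with two binary operations $\cdot$ and $:$ such that for every $x\in X$ the map $\sigma_x:X\to X$, $y\mapsto x\cdot y$ is bijective, and for all $x,y,z\in X$: $(x\cdot y)\cdot(x\cdot z)=(y:x)\cdot(y\cdot z)$, $(x:y):(x:z)=(y\cdot x):(y:z)$, and $(x\cdot y):(x\cdot z)=(y:x)\cdot(y:z)$. It is regular if $\delta_x:X\to X$, $y\mapsto x:y$ is bijective for every $x\in X$. For a regular q-cycle set, $\mathcal{G}(X)=\langle\sigma_x,\delta_x\mid x\in X\rangle\le\mathrm{Sym}_X$, and $X$ is indecomposable if $X$ is regular and $\mathcal{G}(X)$ acts transitively on $X$. All q-cycle sets are finite. A regular q-cycle set $X$ is retractable if $|X|=1$ or there exist distinct $x,y\in X$ with $\sigma_x=\sigma_y$ and $\delta_x=\delta_y$. A finite transitive group $G$ acting on a set $X$ is imprimitive if there is a subset $\Delta$ of $X$, $\Delta\neq X$, with at least two elements (called a block for $G$) such that, for each $g\in G$, either $g(\Delta)=\Delta$ or $g(\Delta)\cap\Delta=\emptyset$.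
   Formalization: The case |X| = 1 is excluded: a one-element q-cycle set is retractable and indecomposable and 1 is not prime, but it has no block with at least two elements, so the claim fails there. *)

theory Defs
  imports "HOL-Algebra.Group_Action" "HOL-Algebra.Generated_Groups"
    "HOL-Computational_Algebra.Primes"
begin

text \<open>The operation written with a colon on paper is written \<open>\<diamondop>\<close> here, since the colon is taken.\<close>

locale q_cycle_set =
  fixes X :: "'a set"
    and dot :: "'a \<Rightarrow> 'a \<Rightarrow> 'a" (infixl \<open>\<cdot>\<close> 70)
    and col :: "'a \<Rightarrow> 'a \<Rightarrow> 'a" (infixl \<open>\<diamondop>\<close> 70)
  assumes nonempty: "X \<noteq> {}"
    and dot_closed: "\<lbrakk>x \<in> X; y \<in> X\<rbrakk> \<Longrightarrow> x \<cdot> y \<in> X"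
    and col_closed: "\<lbrakk>x \<in> X; y \<in> X\<rbrakk> \<Longrightarrow> x \<diamondop> y \<in> X"
    and dot_bij: "x \<in> X \<Longrightarrow> bij_betw (\<lambda>y. x \<cdot> y) X X"
    and dot_dot: "\<lbrakk>x \<in> X; y \<in> X; z \<in> X\<rbrakk> \<Longrightarrow> (x \<cdot> y) \<cdot> (x \<cdot> z) = (y \<diamondop> x) \<cdot> (y \<cdot> z)"
    and col_col: "\<lbrakk>x \<in> X; y \<in> X; z \<in> X\<rbrakk> \<Longrightarrow> (x \<diamondop> y) \<diamondop> (x \<diamondop> z) = (y \<cdot> x) \<diamondop> (y \<diamondop> z)"
    and dot_col: "\<lbrakk>x \<in> X; y \<in> X; z \<in> X\<rbrakk> \<Longrightarrow> (x \<cdot> y) \<diamondop> (x \<cdot> z) = (y \<diamondop> x) \<cdot> (y \<diamondop> z)"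

locale regular_q_cycle_set = q_cycle_set +
  assumes col_bij: "x \<in> X \<Longrightarrow> bij_betw (\<lambda>y. x \<diamondop> y) X X"

text \<open>
  The map \<open>\<sigma>\<^sub>x\<close> is \<open>left_mult X dot x\<close> and \<open>\<delta>\<^sub>x\<close> is \<open>left_mult X col x\<close>.  They are extensional
  on \<open>X\<close>, as required for elements of \<open>BijGroup X\<close>, and so equal iff they agree on \<open>X\<close>.
\<close>

definition left_mult :: "'a set \<Rightarrow> ('a \<Rightarrow> 'a \<Rightarrow> 'a) \<Rightarrow> 'a \<Rightarrow> 'a \<Rightarrow> 'a"
  where "left_mult X f x = (\<lambda>y\<in>X. f x y)"

definition perm_group ::
    "'a set \<Rightarrow> ('a \<Rightarrow> 'a \<Rightarrow> 'a) \<Rightarrow> ('a \<Rightarrow> 'a \<Rightarrow> 'a) \<Rightarrow> ('a \<Rightarrow> 'a) monoid"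
  where "perm_group X dot col =
    (BijGroup X)\<lparr>carrier := generate (BijGroup X) (left_mult X dot ` X \<union> left_mult X col ` X)\<rparr>"

locale indecomposable_q_cycle_set = regular_q_cycle_set +
  assumes transitive: "transitive_action (perm_group X dot col) X (\<lambda>g. g)"

locale retractable_q_cycle_set = regular_q_cycle_set +
  assumes retractable: "card X = 1 \<or>
    (\<exists>x\<in>X. \<exists>y\<in>X. x \<noteq> y \<and> left_mult X dot x = left_mult X dot y
      \<and> left_mult X col x = left_mult X col y)"

definition is_block :: "('g, 'c) monoid_scheme \<Rightarrow> 'a set \<Rightarrow> ('g \<Rightarrow> 'a \<Rightarrow> 'a) \<Rightarrow> 'a set \<Rightarrow> bool"
  where "is_block G E \<phi> \<Delta> \<longleftrightarrow> \<Delta> \<subseteq> E \<and> \<Delta> \<noteq> E \<and> (\<exists>a\<in>\<Delta>. \<exists>b\<in>\<Delta>. a \<noteq> b) \<and>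
    (\<forall>g\<in>carrier G. \<phi> g ` \<Delta> = \<Delta> \<or> \<phi> g ` \<Delta> \<inter> \<Delta> = {})"

locale imprimitive_action = transitive_action +
  assumes finite_group: "finite (carrier G)"
    and ex_block: "\<exists>\<Delta>. is_block G E \<phi> \<Delta>"

end

theory Submission
  imports Defs "HOL-Algebra.Sylow"
begin

text \<open>
  Call \<open>x\<close> and \<open>y\<close> related when \<open>\<sigma>\<^sub>x = \<sigma>\<^sub>y\<close> and \<open>\<delta>\<^sub>x = \<delta>\<^sub>y\<close>.  The identity
  \<open>(z \<cdot> x) \<cdot> (z \<cdot> w) = (x \<diamondop> z) \<cdot> (x \<cdot> w)\<close> shows that left multiplication \<open>\<sigma>\<close> by the element \<open>z \<cdot> x\<close>
  is determined by \<open>z\<close>, \<open>\<sigma>\<^sub>x\<close> and \<open>\<delta>\<^sub>x\<close>, since \<open>z \<cdot> w\<close> runs through all of \<open>X\<close>; the other identities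
  give the same for \<open>\<delta>\<close>, and for both maps at \<open>z \<diamondop> x\<close>.  Hence every \<open>\<sigma>\<^sub>z\<close> and every \<open>\<delta>\<^sub>z\<close> preserves
  the relation, and by finiteness so does the group they generate (\<open>retraction_rel_invariant\<close>).
  Retractability provides two distinct related elements.  Their class is a block, unless it is all
  of \<open>X\<close>, that is, unless the relation is universal (\<open>block_of_invariant_equiv\<close>).

  If the relation is universal, then there are only one map \<open>\<sigma>\<close> and only one map \<open>\<delta>\<close>, and the
  identity mixing the two operations says that they commute; so the group is abelian.  A transitive
  abelian permutation group has trivial point stabilizers, and so its order is \<open>card X\<close>.  For a prime
  \<open>p\<close> dividing \<open>card X\<close>, which is itself not prime, there is a subgroup of order \<open>p\<close>; it lies strictly
  between a point stabilizer and the whole group, and the orbit of the point under it is a block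
  (\<open>comm_group_block\<close>).
\<close>

section \<open>Blocks of group actions\<close>

text \<open>
  Since \<open>g\<close> and \<open>inv g\<close> both preserve \<open>R\<close>, the image of a class under \<open>g\<close> is again a whole class.
  The block is the class of \<open>a\<close>, which has the second element \<open>b\<close>.
\<close>
lemma (in group_action) block_of_invariant_equiv:
  assumes equiv: "equiv E R"
    and inv: "\<And>g x y. \<lbrakk>g \<in> carrier G; (x, y) \<in> R\<rbrakk> \<Longrightarrow> (\<phi> g x, \<phi> g y) \<in> R"
    and ab: "(a, b) \<in> R" "a \<noteq> b"
    and "R \<noteq> E \<times> E"
  shows "\<exists>\<Delta>. is_block G E \<phi> \<Delta>"
proof -
  have sub: "R \<subseteq> E \<times> E" and sym: "sym R" and trans: "trans R" and reflR: "refl_on E R"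
    using equiv by (auto simp: equiv_def)
  have aE: "a \<in> E" using ab sub by auto
  let ?\<Delta> = "R `` {a}"
  have "?\<Delta> \<noteq> E"
  proof
    assume "?\<Delta> = E"
    then have "(x, y) \<in> R" if "x \<in> E" "y \<in> E" for x y
      using that symD[OF sym] transD[OF trans] by blast
    then show False using sub \<open>R \<noteq> E \<times> E\<close> by auto
  qed
  moreover have "\<phi> g ` ?\<Delta> = ?\<Delta> \<or> \<phi> g ` ?\<Delta> \<inter> ?\<Delta> = {}" if g: "g \<in> carrier G" for g
  proof -
    interpret Grp: group G using group_hom group_hom.axioms(1) by auto
    have img: "\<phi> g ` ?\<Delta> = R `` {\<phi> g a}"
    proof
      show "\<phi> g ` ?\<Delta> \<subseteq> R `` {\<phi> g a}" using inv[OF g] by auto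
      show "R `` {\<phi> g a} \<subseteq> \<phi> g ` ?\<Delta>"
      proof
        fix y assume "y \<in> R `` {\<phi> g a}"
        then have y: "(\<phi> g a, y) \<in> R" by simp
        then have "y \<in> E" using sub by auto
        then obtain x where x: "x \<in> E" "\<phi> g x = y" using bij_prop1[OF g] by blast
        have "(\<phi> (inv g) (\<phi> g a), \<phi> (inv g) y) \<in> R" using inv[OF _ y] g by simp
        then have "(a, x) \<in> R"
          using orbit_sym_aux[OF g aE refl] orbit_sym_aux[OF g x] by simp
        then show "y \<in> \<phi> g ` ?\<Delta>" using x by auto
      qed
    qed
    have "\<phi> g a \<in> E" using element_image[OF g aE] by simp
    then have "R `` {\<phi> g a} = R `` {a} \<or> R `` {\<phi> g a} \<inter> R `` {a} = {}"
      using quotient_disj[OF equiv] quotientI aE by metis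
    then show ?thesis unfolding img .
  qed
  moreover have "a \<in> ?\<Delta>" using reflR aE by (auto simp: refl_on_def)
  ultimately have "is_block G E \<phi> ?\<Delta>" unfolding is_block_def using ab sub by blast
  then show ?thesis ..
qed

text \<open>
  The correspondence between blocks through \<open>a\<close> and subgroups above the stabilizer of \<open>a\<close>, in one
  direction.  If \<open>g\<close> sends \<open>h a\<close> to \<open>h' a\<close> with \<open>h\<close>, \<open>h'\<close> in \<open>H\<close>, then \<open>g\<close> itself lies in \<open>H\<close>.
\<close>
lemma (in group_action) block_of_intermediate_subgroup:
  assumes H: "subgroup H G" and a: "a \<in> E"
    and above: "stabilizer G \<phi> a \<subset> H" and below: "H \<subset> carrier G"
  shows "is_block G E \<phi> ((\<lambda>h. \<phi> h a) ` H)" (is "is_block G E \<phi> ?\<Delta>")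
proof -
  interpret Grp: group G using group_hom group_hom.axioms(1) by auto
  interpret H: subgroup H G by fact
  have mem_H: "g \<in> H" if g: "g \<in> carrier G" and k: "k \<in> H" and eq: "\<phi> g a = \<phi> k a" for g k
  proof -
    have kc: "k \<in> carrier G" using k by simp
    have "\<phi> (inv k \<otimes> g) a = a"
      using composition_rule[OF a, of "inv k" g] orbit_sym_aux[OF kc a refl] g kc eq by simp
    then have "inv k \<otimes> g \<in> stabilizer G \<phi> a" using g kc by (simp add: stabilizer_def)
    then have "inv k \<otimes> g \<in> H" using above by blast
    then have "k \<otimes> (inv k \<otimes> g) \<in> H" using k by blast
    then show ?thesis using g kc by (simp add: Grp.inv_solve_left' flip: Grp.m_assoc)
  qed
  have "?\<Delta> \<subseteq> E" using element_image[OF H.mem_carrier a refl] by blast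
  moreover have "?\<Delta> \<noteq> E"
  proof
    assume eq: "?\<Delta> = E"
    obtain g where g: "g \<in> carrier G" "g \<notin> H" using below by auto
    have "\<phi> g a \<in> ?\<Delta>" using eq element_image[OF g(1) a] by simp
    then obtain k where "k \<in> H" "\<phi> g a = \<phi> k a" by blast
    then show False using mem_H[OF g(1)] g(2) by blast
  qed
  moreover have "\<exists>x\<in>?\<Delta>. \<exists>y\<in>?\<Delta>. x \<noteq> y"
  proof -
    obtain h where "h \<in> H" "h \<notin> stabilizer G \<phi> a" using above by auto
    then have "\<phi> h a \<noteq> a" by (auto simp: stabilizer_def)
    moreover have "a = \<phi> \<one> a" using id_eq_one a by (metis restrict_apply')
    ultimately show ?thesis using \<open>h \<in> H\<close> H.one_closed by (metis imageI)
  qed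
  moreover have "\<phi> g ` ?\<Delta> = ?\<Delta> \<or> \<phi> g ` ?\<Delta> \<inter> ?\<Delta> = {}" if g: "g \<in> carrier G" for g
  proof (rule disjCI)
    assume "\<phi> g ` ?\<Delta> \<inter> ?\<Delta> \<noteq> {}"
    then obtain h k where hk: "h \<in> H" "k \<in> H" "\<phi> g (\<phi> h a) = \<phi> k a" by auto
    then have "g \<otimes> h \<in> H" using mem_H[of "g \<otimes> h" k] composition_rule[OF a g, of h] g by simp
    then have "(g \<otimes> h) \<otimes> inv h \<in> H" using hk by blast
    then have gH: "g \<in> H" using g hk by (simp add: Grp.m_assoc)
    have "\<phi> g ` ?\<Delta> = (\<lambda>h. \<phi> (g \<otimes> h) a) ` H"
      using composition_rule[OF a g] by (auto simp: image_image)
    also have "\<dots> = (\<lambda>h. \<phi> h a) ` ((\<lambda>h. g \<otimes> h) ` H)" by (simp add: image_image)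
    also have "(\<lambda>h. g \<otimes> h) ` H = H"
      using Grp.coset_join3[OF _ H gH] g by (auto simp: l_coset_def)
    finally show "\<phi> g ` ?\<Delta> = ?\<Delta>" .
  qed
  ultimately show ?thesis unfolding is_block_def by blast
qed

text \<open>
  If \<open>g\<close> fixes \<open>a\<close>, then it also fixes \<open>k a\<close>, because \<open>g (k a) = k (g a)\<close>; by transitivity \<open>g\<close> fixes
  every point.
\<close>
lemma (in transitive_action) comm_group_stabilizer:
  assumes "comm_group G" and faithful: "inj_on \<phi> (carrier G)" and a: "a \<in> E"
  shows "stabilizer G \<phi> a = {\<one>}"
proof -
  interpret Grp: comm_group G by fact
  have one: "\<phi> \<one> x = x" if "x \<in> E" for x using id_eq_one that by (metis restrict_apply')
  have "g = \<one>" if g: "g \<in> carrier G" and fix_a: "\<phi> g a = a" for g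
  proof -
    have "\<phi> g x = x" if x: "x \<in> E" for x
    proof -
      obtain k where k: "k \<in> carrier G" "\<phi> k a = x" using unique_orbit[OF a x] by blast
      then show ?thesis
        using composition_rule[OF a g k(1)] composition_rule[OF a k(1) g] fix_a
          Grp.m_comm[OF g k(1)] by simp
    qed
    moreover have "\<phi> g \<in> extensional E" "\<phi> \<one> \<in> extensional E"
      using bij_prop0[OF g] bij_prop0[OF Grp.one_closed] by (auto simp: Bij_def)
    ultimately have "\<phi> g = \<phi> \<one>" using one by (metis extensionalityI)
    then show ?thesis using faithful g by (meson Grp.one_closed inj_onD)
  qed
  then show ?thesis using one[OF a] by (auto simp: stabilizer_def)
qed

lemma (in transitive_action) comm_group_block:
  assumes "comm_group G" and faithful: "inj_on \<phi> (carrier G)"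
    and "finite E" "E \<noteq> {}" and not_prime: "\<not> prime (card E)" and "card E \<noteq> 1"
  shows "\<exists>\<Delta>. is_block G E \<phi> \<Delta>"
proof -
  interpret Grp: comm_group G by fact
  obtain a where a: "a \<in> E" using \<open>E \<noteq> {}\<close> by blast
  have stab: "stabilizer G \<phi> a = {\<one>}" by (rule comm_group_stabilizer) fact+
  have "orbit G \<phi> a = E"
    using unique_orbit[OF a] element_image[OF _ a] by (auto simp: orbit_def)
  then have order: "order G = card E" using orbit_stabilizer_theorem[OF a] stab by simp
  have fin: "finite (carrier G)"
    using order \<open>finite E\<close> \<open>E \<noteq> {}\<close> Grp.order_gt_0_iff_finite card_gt_0_iff by metis
  obtain p where p: "prime p" "p dvd card E" using prime_factor_nat[OF \<open>card E \<noteq> 1\<close>] by blast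
  then obtain m where "order G = p ^ 1 * m" unfolding order by auto
  then obtain H where H: "subgroup H G" "card H = p"
    using sylow_thm[OF p(1) Grp.is_group _ fin, of 1] by auto
  have "H \<noteq> carrier G" using H(2) p(1) order not_prime by (auto simp: order_def)
  moreover have "H \<noteq> {\<one>}" using H(2) p(1) by auto
  ultimately have "stabilizer G \<phi> a \<subset> H" "H \<subset> carrier G"
    using stab subgroup.one_closed[OF H(1)] subgroup.subset[OF H(1)] by auto
  then show ?thesis using block_of_intermediate_subgroup[OF H(1) a] by blast
qed

section \<open>Groups generated by commuting elements\<close>

lemma (in group) centralizer_subgroup:
  assumes "T \<subseteq> carrier G"
  shows "subgroup {g \<in> carrier G. \<forall>t\<in>T. g \<otimes> t = t \<otimes> g} G"
proof (rule subgroup.intro)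
  fix x y assume "x \<in> {g \<in> carrier G. \<forall>t\<in>T. g \<otimes> t = t \<otimes> g}" "y \<in> {g \<in> carrier G. \<forall>t\<in>T. g \<otimes> t = t \<otimes> g}"
  then show "x \<otimes> y \<in> {g \<in> carrier G. \<forall>t\<in>T. g \<otimes> t = t \<otimes> g}"
    using assms by (auto simp: subset_iff m_assoc) (metis m_assoc)
next
  fix x assume x: "x \<in> {g \<in> carrier G. \<forall>t\<in>T. g \<otimes> t = t \<otimes> g}"
  have "inv x \<otimes> t = t \<otimes> inv x" if "t \<in> T" for t
  proof -
    have t: "t \<in> carrier G" "x \<in> carrier G" "x \<otimes> t = t \<otimes> x" using that x assms by auto
    then have "t = inv x \<otimes> (t \<otimes> x)" by (metis inv_solve_left m_closed)
    also have "\<dots> = (inv x \<otimes> t) \<otimes> x" using t by (simp add: m_assoc)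
    finally show ?thesis using t by (metis inv_closed inv_solve_right m_closed)
  qed
  then show "inv x \<in> {g \<in> carrier G. \<forall>t\<in>T. g \<otimes> t = t \<otimes> g}" using x by auto
qed (use assms in auto)

text \<open>
  The centralizer of \<open>S\<close> contains \<open>S\<close>, hence the generated group; so \<open>S\<close> lies in the centralizer
  of that group, which then contains the generated group as well.
\<close>
lemma (in group) generate_commute:
  assumes S: "S \<subseteq> carrier G" and comm: "\<And>s t. \<lbrakk>s \<in> S; t \<in> S\<rbrakk> \<Longrightarrow> s \<otimes> t = t \<otimes> s"
    and "g \<in> generate G S" "h \<in> generate G S"
  shows "g \<otimes> h = h \<otimes> g"
proof -
  let ?C = "\<lambda>T. {g \<in> carrier G. \<forall>t\<in>T. g \<otimes> t = t \<otimes> g}"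
  have "generate G S \<subseteq> ?C S"
    using generate_subgroup_incl[OF _ centralizer_subgroup[OF S]] S comm by blast
  then have "S \<subseteq> ?C (generate G S)" using S by fastforce
  then have "generate G S \<subseteq> ?C (generate G S)"
    using generate_subgroup_incl[OF _ centralizer_subgroup[OF generate_incl[OF S]]] by blast
  then show ?thesis using assms by blast
qed

section \<open>The retraction of a q-cycle set\<close>

definition retraction_rel ::
    "'a set \<Rightarrow> ('a \<Rightarrow> 'a \<Rightarrow> 'a) \<Rightarrow> ('a \<Rightarrow> 'a \<Rightarrow> 'a) \<Rightarrow> ('a \<times> 'a) set"
  where "retraction_rel X dot col = {(x, y) \<in> X \<times> X.
    left_mult X dot x = left_mult X dot y \<and> left_mult X col x = left_mult X col y}"

lemma left_mult_eq_iff: "left_mult X f x = left_mult X f y \<longleftrightarrow> (\<forall>w\<in>X. f x w = f y w)"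
  by (auto simp: left_mult_def fun_eq_iff)

lemma retraction_rel_iff:
  "(x, y) \<in> retraction_rel X dot col \<longleftrightarrow>
    x \<in> X \<and> y \<in> X \<and> (\<forall>w\<in>X. dot x w = dot y w \<and> col x w = col y w)"
  by (auto simp: retraction_rel_def left_mult_eq_iff)

lemma equiv_retraction_rel: "equiv X (retraction_rel X dot col)"
  by (auto simp: equiv_def refl_on_def sym_def trans_def retraction_rel_def)

text \<open>
  Inverses of generators are the only difficulty.  A permutation that maps a finite relation into
  itself maps it onto itself, and so its inverse preserves the relation too.
\<close>
lemma generate_BijGroup_preserves:
  assumes fin: "finite X" and R: "R \<subseteq> X \<times> X" and S: "S \<subseteq> Bij X"
    and pres: "\<And>s x y. \<lbrakk>s \<in> S; (x, y) \<in> R\<rbrakk> \<Longrightarrow> (s x, s y) \<in> R"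
    and "g \<in> generate (BijGroup X) S" "(x, y) \<in> R"
  shows "(g x, g y) \<in> R"
  using assms(5,6)
proof (induction arbitrary: x y)
  case one
  then show ?case using R by (auto simp: BijGroup_def)
next
  case (incl s)
  then show ?case using pres by blast
next
  case (inv s)
  have s: "s \<in> Bij X" using inv S by blast
  then have inj: "inj_on s X" by (simp add: Bij_def bij_betw_def)
  have "finite R" using R fin by (meson finite_SigmaI finite_subset)
  moreover have "map_prod s s ` R \<subseteq> R" using pres[OF inv(1)] by auto
  moreover have "inj_on (map_prod s s) R"
    using map_prod_inj_on[OF inj inj] R by (rule inj_on_subset)
  ultimately have "map_prod s s ` R = R" by (rule endo_inj_surj)
  then have "(x, y) \<in> map_prod s s ` R" using inv by simp
  then obtain x' y' where x': "(x', y') \<in> R" "x = s x'" "y = s y'" by auto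
  moreover have "x' \<in> X" "y' \<in> X" "x \<in> X" "y \<in> X" using x' inv R by auto
  ultimately show ?case using inv_BijGroup[OF s] inj by (simp add: inv_into_f_f)
next
  case (eng g h)
  have "generate (BijGroup X) S \<subseteq> Bij X"
    using group.generate_incl[OF group_BijGroup] S by (simp add: BijGroup_def)
  then have "g \<in> Bij X" "h \<in> Bij X" using eng by auto
  moreover have "x \<in> X" "y \<in> X" using eng R by auto
  ultimately show ?case using eng by (simp add: BijGroup_def compose_eq)
qed

context regular_q_cycle_set
begin

abbreviation left_mults :: "('a \<Rightarrow> 'a) set"
  where "left_mults \<equiv> left_mult X dot ` X \<union> left_mult X col ` X"

lemma left_mults_Bij: "left_mults \<subseteq> Bij X"
  using dot_bij col_bij bij_betw_restrict_eq
  by (auto simp: left_mult_def Bij_def)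

lemma left_mults_preserve_retraction_rel:
  assumes s: "s \<in> left_mults" and xy: "(x, y) \<in> retraction_rel X dot col"
  shows "(s x, s y) \<in> retraction_rel X dot col"
proof -
  have X: "x \<in> X" "y \<in> X" and eq: "\<And>w. w \<in> X \<Longrightarrow> x \<cdot> w = y \<cdot> w \<and> x \<diamondop> w = y \<diamondop> w"
    using xy by (auto simp: retraction_rel_iff)
  obtain z where z: "z \<in> X" "s = left_mult X dot z \<or> s = left_mult X col z" using s by auto
  have onto: "\<exists>v\<in>X. w = z \<cdot> v" "\<exists>v\<in>X. w = z \<diamondop> v" if "w \<in> X" for w
    using dot_bij[OF z(1)] col_bij[OF z(1)] that by (auto simp: bij_betw_def)
  \<comment> \<open>Every argument \<open>w\<close> is written as \<open>z \<cdot> v\<close> or as \<open>z \<diamondop> v\<close>, so that the identities apply.\<close>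
  have "(z \<cdot> x) \<cdot> w = (z \<cdot> y) \<cdot> w \<and> (z \<cdot> x) \<diamondop> w = (z \<cdot> y) \<diamondop> w" if w: "w \<in> X" for w
  proof -
    obtain v where "v \<in> X" "w = z \<cdot> v" using onto(1)[OF w] by blast
    then show ?thesis using dot_dot[of z _ v] dot_col[of z _ v] z X eq by simp
  qed
  moreover have "(z \<diamondop> x) \<cdot> w = (z \<diamondop> y) \<cdot> w \<and> (z \<diamondop> x) \<diamondop> w = (z \<diamondop> y) \<diamondop> w"
    if w: "w \<in> X" for w
  proof -
    obtain v where "v \<in> X" "w = z \<diamondop> v" using onto(2)[OF w] by blast
    then show ?thesis using col_col[of z _ v] dot_col[of _ z v, symmetric] z X eq by simp
  qed
  ultimately show ?thesis
    using z X dot_closed col_closed by (auto simp: retraction_rel_iff left_mult_def)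
qed

lemma retraction_rel_invariant:
  assumes "finite X" "g \<in> carrier (perm_group X dot col)" "(x, y) \<in> retraction_rel X dot col"
  shows "(g x, g y) \<in> retraction_rel X dot col"
proof (rule generate_BijGroup_preserves[where S = left_mults and g = g])
  show "g \<in> generate (BijGroup X) left_mults" using assms(2) by (simp add: perm_group_def)
  show "retraction_rel X dot col \<subseteq> X \<times> X" by (auto simp: retraction_rel_def)
qed (use assms left_mults_Bij left_mults_preserve_retraction_rel in simp_all)

lemma subgroup_generate_left_mults:
  "subgroup (generate (BijGroup X) left_mults) (BijGroup X)"
proof (rule group.generate_is_subgroup[OF group_BijGroup])
  show "left_mults \<subseteq> carrier (BijGroup X)" using left_mults_Bij by (simp add: BijGroup_def)
qed

lemma finite_perm_group: "finite X \<Longrightarrow> finite (carrier (perm_group X dot col))"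
proof -
  assume "finite X"
  then have "finite (X \<rightarrow>\<^sub>E X)" by (simp add: finite_PiE)
  moreover have "Bij X \<subseteq> X \<rightarrow>\<^sub>E X" using Bij_imp_funcset Bij_imp_extensional by (auto simp: PiE_def)
  moreover have "carrier (perm_group X dot col) \<subseteq> Bij X"
    using subgroup.subset[OF subgroup_generate_left_mults]
    by (simp add: perm_group_def BijGroup_def)
  ultimately show ?thesis by (meson finite_subset)
qed

text \<open>
  If all \<open>\<sigma>\<^sub>x\<close> coincide and all \<open>\<delta>\<^sub>x\<close> coincide, the mixed identity reads \<open>\<delta> \<circ> \<sigma> = \<sigma> \<circ> \<delta>\<close>.
\<close>
lemma comm_group_perm_group:
  assumes univ: "retraction_rel X dot col = X \<times> X"
  shows "comm_group (perm_group X dot col)"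
proof -
  interpret B: group "BijGroup X" by (rule group_BijGroup)
  have sub: "left_mults \<subseteq> carrier (BijGroup X)"
    using left_mults_Bij by (simp add: BijGroup_def)
  have dot: "x \<cdot> w = y \<cdot> w" and col: "x \<diamondop> w = y \<diamondop> w" if "x \<in> X" "y \<in> X" "w \<in> X" for x y w
    using univ that retraction_rel_iff[of x y X dot col] by auto
  have mixed: "x \<diamondop> (y \<cdot> w) = y \<cdot> (x \<diamondop> w)" if "x \<in> X" "y \<in> X" "w \<in> X" for x y w
  proof -
    have "x \<diamondop> (y \<cdot> w) = (y \<cdot> y) \<diamondop> (y \<cdot> w)"
      using that dot_closed by (intro col) auto
    also have "\<dots> = (y \<diamondop> y) \<cdot> (y \<diamondop> w)" using that by (intro dot_col) auto
    also have "\<dots> = y \<cdot> (y \<diamondop> w)" using that col_closed by (intro dot) auto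
    also have "y \<diamondop> w = x \<diamondop> w" using that by (intro col) auto
    finally show ?thesis .
  qed
  have comm: "s \<otimes>\<^bsub>BijGroup X\<^esub> t = t \<otimes>\<^bsub>BijGroup X\<^esub> s"
    if st: "s \<in> left_mults" "t \<in> left_mults" for s t
  proof -
    have "s (t w) = t (s w)" if w: "w \<in> X" for w
    proof -
      obtain x where x: "x \<in> X" "s = left_mult X dot x \<or> s = left_mult X col x"
        using st by auto
      obtain y where y: "y \<in> X" "t = left_mult X dot y \<or> t = left_mult X col y"
        using st by auto
      have "x \<cdot> (y \<cdot> w) = y \<cdot> (x \<cdot> w)" "x \<diamondop> (y \<diamondop> w) = y \<diamondop> (x \<diamondop> w)"
        using x(1) y(1) w dot[of x y] col[of x y] dot_closed col_closed by simp_all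
      moreover have "x \<diamondop> (y \<cdot> w) = y \<cdot> (x \<diamondop> w)" "x \<cdot> (y \<diamondop> w) = y \<diamondop> (x \<cdot> w)"
        using mixed[of x y w] mixed[of y x w] x(1) y(1) w by simp_all
      ultimately show ?thesis
        using x y w dot_closed col_closed by (auto simp: left_mult_def)
    qed
    then show ?thesis
      using st left_mults_Bij by (auto simp: BijGroup_def subset_iff compose_def)
  qed
  have "group (perm_group X dot col)"
    unfolding perm_group_def using B.subgroup_imp_group[OF subgroup_generate_left_mults] .
  then show ?thesis
    using B.generate_commute[OF sub comm]
    by (intro group.group_comm_groupI) (auto simp: perm_group_def)
qed

end

theorem theorem2p4:
  fixes X :: "'a set" and dot col :: "'a \<Rightarrow> 'a \<Rightarrow> 'a"
  assumes "finite X"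
    and "indecomposable_q_cycle_set X dot col"
    and "retractable_q_cycle_set X dot col"
    and "\<not> prime (card X)"
    and "card X \<noteq> 1"
  shows "imprimitive_action (perm_group X dot col) X (\<lambda>g. g)"
proof -
  interpret indecomposable_q_cycle_set X dot col by fact
  interpret act: transitive_action "perm_group X dot col" X "\<lambda>g. g" by (rule transitive)
  have "\<exists>\<Delta>. is_block (perm_group X dot col) X (\<lambda>g. g) \<Delta>"
  proof (cases "retraction_rel X dot col = X \<times> X")
    case True
    show ?thesis
      by (rule act.comm_group_block[OF comm_group_perm_group[OF True] _ \<open>finite X\<close> nonempty])
        (use assms in auto)
  next
    case False
    obtain x y where xy: "(x, y) \<in> retraction_rel X dot col" "x \<noteq> y"
      using retractable_q_cycle_set.retractable[OF assms(3)] \<open>card X \<noteq> 1\<close>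
      by (auto simp: retraction_rel_def)
    show ?thesis
    proof (rule act.block_of_invariant_equiv)
      show "equiv X (retraction_rel X dot col)" by (rule equiv_retraction_rel)
    qed (fact xy False retraction_rel_invariant[OF \<open>finite X\<close>])+
  qed
  then show ?thesis
    using finite_perm_group[OF \<open>finite X\<close>]
    by (intro imprimitive_action.intro imprimitive_action_axioms.intro
        act.transitive_action_axioms)
qed

end
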